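(* Let $\mathfrak g=\mathfrak g_{-3}\oplus\cdots\oplus\mathfrak g_3$ be the $\mathbb Z$-grading of $\mathfrak g=G(3)$ associated with the parabolic subalgebra $\mathfrak p_2^{\rm IV}$ (grading element $\mathsf Z_2$) and $\mathfrak m=\mathfrak g_{-3}\oplus\mathfrak g_{-2}\oplus\mathfrak g_{-1}$. Then $H^{d,1}(\mathfrak m,\mathfrak g)=0$ for all $d\ge0$.
   Context: $G(3)$: complex exceptional simple Lie superalgebra of dimension $(17|14)$ with $\mathfrak g_{\bar0}=G(2)\oplus A(1)$, $\mathfrak g_{\bar1}=\mathbb C^7\boxtimes\mathbb C^2$. With a Cartan subalgebra $\mathfrak h$ and $\delta,\epsilon_i\in\mathfrak h^*$ ($\epsilon_1+\epsilon_2+\epsilon_3=0$, $\langle\epsilon_i,\epsilon_j\rangle=1-3\delta_{ij}$, $\langle\delta,\delta\rangle=2$, $\langle\epsilon_i,\delta\rangle=0$; even roots $\pm2\delta,\pm\epsilon_i,\epsilon_i-\epsilon_j$, odd roots $\pm\delta,\pm\delta\pm\epsilon_i$), take simple roots $\alpha_1=\epsilon_2-\epsilon_1$, $\alpha_2=\epsilon_1-\delta$, $\alpha_3=\delta$ with dual basis $\mathsf Z_1,\mathsf Z_2,\mathsf Z_3\in\mathfrak h$; $\mathfrak g_k=\{x:[\mathsf Z_2,x]=kx\}$. Spencer cohomology $H^{d,n}(\mathfrak m,\mathfrak g)$: the degree-$d$ component of the Chevalley–Eilenberg cohomology of $\mathfrak m$ with coefficients in the adjoint module $\mathfrak g$ (cochains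 $\mathfrak g\otimes\Lambda^n\mathfrak m^*$ in the super sense), where $\mathfrak g_j^*$ has degree $-j$. *)

theory Defs
  imports Complex_Main
begin

text \<open>
  An explicit model of the exceptional Lie superalgebra G(3) over the complex numbers,
  of dimension (17|14), given by structure constants in a Chevalley-type basis e_0,...,e_30.

  Construction (verified by computer: super skew-symmetry and super Jacobi identity hold):
  C^7 with basis e_1,e_2,e_3,e_{-1},e_{-2},e_{-3},e_0 of weights eps_1,eps_2,eps_3,-eps_1,-eps_2,-eps_3,0,
  symmetric form B(e_i,e_{-i}) = 1, B(e_0,e_0) = -2; G(2) is the stabiliser in so(7,B) of the
  3-form e_1 e_2 e_3 + e_{-1} e_{-2} e_{-3} + sum_i e_i e_{-i} e_0.  sl_2 acts on C^2 = span(s_+,s_-)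
  (weights +delta, -delta), omega(s_+,s_-) = 1.  The even part is G(2) + sl_2, the odd part is
  C^7 (x) C^2, and the odd-odd bracket is
     [u(x)s, v(x)t] = 3 omega(s,t) pr_G2(u wedge v) - 2 B(u,v) (s t),
  with (u wedge v)(w) = B(u,w)v - B(v,w)u, (s t)(r) = omega(s,r)t + omega(t,r)s and pr_G2 the
  trace-form orthogonal projection so(7) -> G(2).

  The Cartan subalgebra is spanned by e_0, e_1, e_2, which are exactly the elements Z_1, Z_2, Z_3
  dual to the simple roots alpha_1 = eps_2 - eps_1, alpha_2 = eps_1 - delta, alpha_3 = delta.
  All other basis vectors are root vectors; below, "root (a,b,c)" means the root
  a alpha_1 + b alpha_2 + c alpha_3, so that [Z_i, e_k] = (i-th coordinate) e_k for all k.
  Basis: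
   0 : Z_1                  parity 0, root 0 (Cartan)
   1 : Z_2                  parity 0, root 0 (Cartan)
   2 : Z_3                  parity 0, root 0 (Cartan)
   3 : G(2) root vector     parity 0, root (-1,-3,-3)
   4 : G(2) root vector     parity 0, root (-2,-3,-3)
   5 : G(2) root vector     parity 0, root (-1,-2,-2)
   6 : G(2) root vector     parity 0, root (0,-1,-1)
   7 : G(2) root vector     parity 0, root (1,0,0)
   8 : G(2) root vector     parity 0, root (-1,-1,-1)
   9 : G(2) root vector     parity 0, root (1,1,1)
  10 : G(2) root vector     parity 0, root (-1,0,0)
  11 : G(2) root vector     parity 0, root (0,1,1)
  12 : G(2) root vector     parity 0, root (1,2,2)
  13 : G(2) root vector     parity 0, root (2,3,3)
  14 : G(2) root vector     parity 0, root (1,3,3)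
  15 : E (sl_2 raising)     parity 0, root (0,0,2)
  16 : F (sl_2 lowering)    parity 0, root (0,0,-2)
  17 : odd root vector      parity 1, root (0,1,2)
  18 : odd root vector      parity 1, root (0,1,0)
  19 : odd root vector      parity 1, root (1,1,2)
  20 : odd root vector      parity 1, root (1,1,0)
  21 : odd root vector      parity 1, root (-1,-2,-1)
  22 : odd root vector      parity 1, root (-1,-2,-3)
  23 : odd root vector      parity 1, root (0,-1,0)
  24 : odd root vector      parity 1, root (0,-1,-2)
  25 : odd root vector      parity 1, root (-1,-1,0)
  26 : odd root vector      parity 1, root (-1,-1,-2)
  27 : odd root vector      parity 1, root (1,2,3)
  28 : odd root vector      parity 1, root (1,2,1)
  29 : odd root vector      parity 1, root (0,0,1)
  30 : odd root vector      parity 1, root (0,0,-1)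
\<close>

definition g3_dim :: nat where "g3_dim = 31"

definition g3_par_tbl :: "nat list" where
  "g3_par_tbl = [0, 0, 0, 0, 0, 0, 0, 0, 0, 0, 0, 0, 0, 0, 0, 0, 0, 1, 1, 1, 1, 1, 1, 1, 1, 1, 1, 1, 1, 1, 1]"

definition g3_par :: "nat \<Rightarrow> nat" where "g3_par i = g3_par_tbl ! i"

text \<open>Roots of the basis vectors in simple root coordinates (documentation only;
  the grading below is defined intrinsically via the eigenvalues of ad Z_2).\<close>
definition g3_root_tbl :: "(int \<times> int \<times> int) list" where
  "g3_root_tbl = [(0,0,0), (0,0,0), (0,0,0), (-1,-3,-3), (-2,-3,-3), (-1,-2,-2), (0,-1,-1), (1,0,0), (-1,-1,-1), (1,1,1), (-1,0,0), (0,1,1), (1,2,2), (2,3,3), (1,3,3), (0,0,2), (0,0,-2), (0,1,2), (0,1,0), (1,1,2), (1,1,0), (-1,-2,-1), (-1,-2,-3), (0,-1,0), (0,-1,-2), (-1,-1,0), (-1,-1,-2), (1,2,3), (1,2,1), (0,0,1), (0,0,-1)]"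

text \<open>Nonzero structure constants: an entry (i,j,k,p,q) means that the coefficient of e_k in
  [e_i,e_j] is p/q.\<close>
definition g3_sc_tbl :: "(nat \<times> nat \<times> nat \<times> int \<times> int) list" where
  "g3_sc_tbl = [
   (0,3,3,-1,1), (0,4,4,-2,1), (0,5,5,-1,1), (0,7,7,1,1), (0,8,8,-1,1), (0,9,9,1,1), (0,10,10,-1,1), (0,12,12,1,1),
   (0,13,13,2,1), (0,14,14,1,1), (0,19,19,1,1), (0,20,20,1,1), (0,21,21,-1,1), (0,22,22,-1,1), (0,25,25,-1,1), (0,26,26,-1,1),
   (0,27,27,1,1), (0,28,28,1,1), (1,3,3,-3,1), (1,4,4,-3,1), (1,5,5,-2,1), (1,6,6,-1,1), (1,8,8,-1,1), (1,9,9,1,1),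
   (1,11,11,1,1), (1,12,12,2,1), (1,13,13,3,1), (1,14,14,3,1), (1,17,17,1,1), (1,18,18,1,1), (1,19,19,1,1), (1,20,20,1,1),
   (1,21,21,-2,1), (1,22,22,-2,1), (1,23,23,-1,1), (1,24,24,-1,1), (1,25,25,-1,1), (1,26,26,-1,1), (1,27,27,2,1), (1,28,28,2,1),
   (2,3,3,-3,1), (2,4,4,-3,1), (2,5,5,-2,1), (2,6,6,-1,1), (2,8,8,-1,1), (2,9,9,1,1), (2,11,11,1,1), (2,12,12,2,1),
   (2,13,13,3,1), (2,14,14,3,1), (2,15,15,2,1), (2,16,16,-2,1), (2,17,17,2,1), (2,19,19,2,1), (2,21,21,-1,1), (2,22,22,-3,1),
   (2,24,24,-2,1), (2,26,26,-2,1), (2,27,27,3,1), (2,28,28,1,1), (2,29,29,1,1), (2,30,30,-1,1), (3,0,3,1,1), (3,1,3,3,1),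
   (3,2,3,3,1), (3,10,4,1,1), (3,11,5,1,1), (3,12,6,-1,1), (3,13,7,-1,1), (3,14,0,1,1), (3,14,1,-1,1), (3,17,21,1,1),
   (3,18,22,1,1), (3,27,23,-1,1), (3,28,24,-1,1), (4,0,4,2,1), (4,1,4,3,1), (4,2,4,3,1), (4,7,3,1,1), (4,9,5,1,1),
   (4,12,8,1,1), (4,13,0,-1,1), (4,14,10,-1,1), (4,19,21,1,1), (4,20,22,1,1), (4,27,25,-1,1), (4,28,26,-1,1), (5,0,5,1,1),
   (5,1,5,2,1), (5,2,5,2,1), (5,6,3,3,2), (5,8,4,-3,2), (5,9,6,-1,2), (5,11,8,-1,2), (5,12,1,-1,2), (5,13,9,-1,1),
   (5,14,11,-1,1), (5,17,25,1,2), (5,18,26,1,2), (5,19,23,-1,2), (5,20,24,-1,2), (5,27,29,1,2), (5,28,30,1,2), (5,29,21,1,1),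
   (5,30,22,1,1), (6,1,6,1,1), (6,2,6,1,1), (6,5,3,-3,2), (6,8,5,4,1), (6,9,7,-3,2), (6,10,8,-1,1), (6,11,0,3,2),
   (6,11,1,-1,1), (6,12,9,4,1), (6,14,12,1,1), (6,17,29,1,1), (6,18,30,1,1), (6,25,21,-1,1), (6,26,22,-1,1), (6,27,19,1,1),
   (6,28,20,1,1), (6,29,23,2,1), (6,30,24,2,1), (7,0,7,-1,1), (7,4,3,-1,1), (7,8,6,1,1), (7,10,0,2,1), (7,10,1,-1,1),
   (7,11,9,1,1), (7,14,13,1,1), (7,17,19,1,1), (7,18,20,1,1), (7,25,23,-1,1), (7,26,24,-1,1), (8,0,8,1,1), (8,1,8,1,1),
   (8,2,8,1,1), (8,5,4,3,2), (8,6,5,-4,1), (8,7,6,-1,1), (8,9,0,3,2), (8,9,1,-1,2), (8,11,10,3,2), (8,12,11,4,1),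
   (8,13,12,-1,1), (8,19,29,-1,1), (8,20,30,-1,1), (8,23,21,-1,1), (8,24,22,-1,1), (8,27,17,1,1), (8,28,18,1,1), (8,29,25,-2,1),
   (8,30,26,-2,1), (9,0,9,-1,1), (9,1,9,-1,1), (9,2,9,-1,1), (9,4,5,-1,1), (9,5,6,1,2), (9,6,7,3,2), (9,8,0,-3,2),
   (9,8,1,1,2), (9,10,11,-1,1), (9,11,12,-1,2), (9,12,13,3,2), (9,17,27,-1,2), (9,18,28,-1,2), (9,21,23,1,2), (9,22,24,1,2),
   (9,25,29,1,2), (9,26,30,1,2), (9,29,19,1,1), (9,30,20,1,1), (10,0,10,1,1), (10,3,4,-1,1), (10,6,8,1,1), (10,7,0,-2,1),
   (10,7,1,1,1), (10,9,11,1,1), (10,13,14,1,1), (10,19,17,1,1), (10,20,18,1,1), (10,23,25,-1,1), (10,24,26,-1,1), (11,1,11,-1,1),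
   (11,2,11,-1,1), (11,3,5,-1,1), (11,5,8,1,2), (11,6,0,-3,2), (11,6,1,1,1), (11,7,9,-1,1), (11,8,10,-3,2), (11,9,12,1,2),
   (11,12,14,3,2), (11,19,27,1,2), (11,20,28,1,2), (11,21,25,-1,2), (11,22,26,-1,2), (11,23,29,1,2), (11,24,30,1,2), (11,29,17,1,1),
   (11,30,18,1,1), (12,0,12,-1,1), (12,1,12,-2,1), (12,2,12,-2,1), (12,3,6,1,1), (12,4,8,-1,1), (12,5,1,1,2), (12,6,9,-4,1),
   (12,8,11,-4,1), (12,9,13,-3,2), (12,11,14,-3,2), (12,21,29,1,1), (12,22,30,1,1), (12,23,19,-1,1), (12,24,20,-1,1), (12,25,17,1,1),
   (12,26,18,1,1), (12,29,27,2,1), (12,30,28,2,1), (13,0,13,-2,1), (13,1,13,-3,1), (13,2,13,-3,1), (13,3,7,1,1), (13,4,0,1,1),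
   (13,5,9,1,1), (13,8,12,1,1), (13,10,14,-1,1), (13,21,19,1,1), (13,22,20,1,1), (13,25,27,-1,1), (13,26,28,-1,1), (14,0,14,-1,1),
   (14,1,14,-3,1), (14,2,14,-3,1), (14,3,0,-1,1), (14,3,1,1,1), (14,4,10,1,1), (14,5,11,1,1), (14,6,12,-1,1), (14,7,13,-1,1),
   (14,21,17,1,1), (14,22,18,1,1), (14,23,27,-1,1), (14,24,28,-1,1), (15,2,15,-2,1), (15,16,1,-1,1), (15,16,2,1,1), (15,18,17,1,1),
   (15,20,19,1,1), (15,22,21,1,1), (15,24,23,1,1), (15,26,25,1,1), (15,28,27,1,1), (15,30,29,1,1), (16,2,16,2,1), (16,15,1,1,1),
   (16,15,2,-1,1), (16,17,18,1,1), (16,19,20,1,1), (16,21,22,1,1), (16,23,24,1,1), (16,25,26,1,1), (16,27,28,1,1), (16,29,30,1,1),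
   (17,1,17,-1,1), (17,2,17,-2,1), (17,3,21,-1,1), (17,5,25,-1,2), (17,6,29,-1,1), (17,7,19,-1,1), (17,9,27,1,2), (17,16,18,-1,1),
   (17,20,12,-1,1), (17,22,8,-1,1), (17,23,15,-4,1), (17,24,0,3,1), (17,24,1,-4,1), (17,24,2,2,1), (17,26,10,-3,1), (17,28,14,-3,1),
   (17,30,11,4,1), (18,1,18,-1,1), (18,3,22,-1,1), (18,5,26,-1,2), (18,6,30,-1,1), (18,7,20,-1,1), (18,9,28,1,2), (18,15,17,-1,1),
   (18,19,12,1,1), (18,21,8,1,1), (18,23,0,-3,1), (18,23,2,2,1), (18,24,16,4,1), (18,25,10,3,1), (18,27,14,3,1), (18,29,11,-4,1),
   (19,0,19,-1,1), (19,1,19,-1,1), (19,2,19,-2,1), (19,4,21,-1,1), (19,5,23,1,2), (19,8,29,1,1), (19,10,17,-1,1), (19,11,27,-1,2),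
   (19,16,20,-1,1), (19,18,12,1,1), (19,22,6,-1,1), (19,24,7,-3,1), (19,25,15,-4,1), (19,26,0,-3,1), (19,26,1,-1,1), (19,26,2,2,1),
   (19,28,13,-3,1), (19,30,9,4,1), (20,0,20,-1,1), (20,1,20,-1,1), (20,4,22,-1,1), (20,5,24,1,2), (20,8,30,1,1), (20,10,18,-1,1),
   (20,11,28,-1,2), (20,15,19,-1,1), (20,17,12,-1,1), (20,21,6,1,1), (20,23,7,3,1), (20,25,0,3,1), (20,25,1,-3,1), (20,25,2,2,1),
   (20,26,16,4,1), (20,27,13,3,1), (20,29,9,-4,1), (21,0,21,1,1), (21,1,21,2,1), (21,2,21,1,1), (21,9,23,-1,2), (21,11,25,1,2),
   (21,12,29,-1,1), (21,13,19,-1,1), (21,14,17,-1,1), (21,16,22,-1,1), (21,18,8,1,1), (21,20,6,1,1), (21,24,3,-3,1), (21,26,4,-3,1),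
   (21,27,15,-4,1), (21,28,1,-1,1), (21,28,2,2,1), (21,30,5,4,1), (22,0,22,1,1), (22,1,22,2,1), (22,2,22,3,1), (22,9,24,-1,2),
   (22,11,26,1,2), (22,12,30,-1,1), (22,13,20,-1,1), (22,14,18,-1,1), (22,15,21,-1,1), (22,17,8,-1,1), (22,19,6,-1,1), (22,23,3,3,1),
   (22,25,4,3,1), (22,27,1,-3,1), (22,27,2,2,1), (22,28,16,4,1), (22,29,5,-4,1), (23,1,23,1,1), (23,8,21,1,1), (23,10,25,1,1),
   (23,11,29,-1,2), (23,12,19,1,1), (23,14,27,1,1), (23,16,24,-1,1), (23,17,15,-4,1), (23,18,0,-3,1), (23,18,2,2,1), (23,20,7,3,1),
   (23,22,3,3,1), (23,26,5,2,1), (23,28,9,-2,1), (23,30,6,2,1), (24,1,24,1,1), (24,2,24,2,1), (24,8,22,1,1), (24,10,26,1,1),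
   (24,11,30,-1,2), (24,12,20,1,1), (24,14,28,1,1), (24,15,23,-1,1), (24,17,0,3,1), (24,17,1,-4,1), (24,17,2,2,1), (24,18,16,4,1),
   (24,19,7,-3,1), (24,21,3,-3,1), (24,25,5,-2,1), (24,27,9,2,1), (24,29,6,-2,1), (25,0,25,1,1), (25,1,25,1,1), (25,6,21,1,1),
   (25,7,23,1,1), (25,9,29,-1,2), (25,12,17,-1,1), (25,13,27,1,1), (25,16,26,-1,1), (25,18,10,3,1), (25,19,15,-4,1), (25,20,0,3,1),
   (25,20,1,-3,1), (25,20,2,2,1), (25,22,4,3,1), (25,24,5,-2,1), (25,28,11,2,1), (25,30,8,-2,1), (26,0,26,1,1), (26,1,26,1,1),
   (26,2,26,2,1), (26,6,22,1,1), (26,7,24,1,1), (26,9,30,-1,2), (26,12,18,-1,1), (26,13,28,1,1), (26,15,25,-1,1), (26,17,10,-3,1),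
   (26,19,0,-3,1), (26,19,1,-1,1), (26,19,2,2,1), (26,20,16,4,1), (26,21,4,-3,1), (26,23,5,2,1), (26,27,11,-2,1), (26,29,8,2,1),
   (27,0,27,-1,1), (27,1,27,-2,1), (27,2,27,-3,1), (27,3,23,1,1), (27,4,25,1,1), (27,5,29,-1,2), (27,6,19,-1,1), (27,8,17,-1,1),
   (27,16,28,-1,1), (27,18,14,3,1), (27,20,13,3,1), (27,21,15,-4,1), (27,22,1,-3,1), (27,22,2,2,1), (27,24,9,2,1), (27,26,11,-2,1),
   (27,30,12,2,1), (28,0,28,-1,1), (28,1,28,-2,1), (28,2,28,-1,1), (28,3,24,1,1), (28,4,26,1,1), (28,5,30,-1,2), (28,6,20,-1,1),
   (28,8,18,-1,1), (28,15,27,-1,1), (28,17,14,-3,1), (28,19,13,-3,1), (28,21,1,-1,1), (28,21,2,2,1), (28,22,16,4,1), (28,23,9,-2,1),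
   (28,25,11,2,1), (28,29,12,-2,1), (29,2,29,-1,1), (29,5,21,-1,1), (29,6,23,-2,1), (29,8,25,2,1), (29,9,19,-1,1), (29,11,17,-1,1),
   (29,12,27,-2,1), (29,16,30,-1,1), (29,18,11,-4,1), (29,20,9,-4,1), (29,22,5,-4,1), (29,24,6,-2,1), (29,26,8,2,1), (29,28,12,-2,1),
   (29,29,15,8,1), (29,30,1,4,1), (29,30,2,-4,1), (30,2,30,1,1), (30,5,22,-1,1), (30,6,24,-2,1), (30,8,26,2,1), (30,9,20,-1,1),
   (30,11,18,-1,1), (30,12,28,-2,1), (30,15,29,-1,1), (30,17,11,4,1), (30,19,9,4,1), (30,21,5,4,1), (30,23,6,2,1), (30,25,8,-2,1),
   (30,27,12,2,1), (30,29,1,4,1), (30,29,2,-4,1), (30,30,16,-8,1)]"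

definition g3_sc :: "nat \<Rightarrow> nat \<Rightarrow> nat \<Rightarrow> complex" where
  "g3_sc i j k = (\<Sum>(a,b,c,p,q)\<leftarrow>g3_sc_tbl.
      if a = i \<and> b = j \<and> c = k then of_int p / of_int q else 0)"

type_synonym vec = "nat \<Rightarrow> complex"

definition g3 :: "vec set" where "g3 = {x. \<forall>i\<ge>g3_dim. x i = 0}"

definition vadd :: "vec \<Rightarrow> vec \<Rightarrow> vec" where "vadd x y = (\<lambda>k. x k + y k)"
definition vsmul :: "complex \<Rightarrow> vec \<Rightarrow> vec" where "vsmul c x = (\<lambda>k. c * x k)"
definition vzero :: vec where "vzero = (\<lambda>k. 0)"
definition basis_vec :: "nat \<Rightarrow> vec" where "basis_vec i = (\<lambda>k. if k = i then 1 else 0)"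

definition g3_br :: "vec \<Rightarrow> vec \<Rightarrow> vec" where
  "g3_br x y = (\<lambda>k. if k < g3_dim then
       (\<Sum>i<g3_dim. \<Sum>j<g3_dim. x i * y j * g3_sc i j k) else 0)"

definition g3_parity_part :: "nat \<Rightarrow> vec set" where
  "g3_parity_part p = {x \<in> g3. \<forall>i. g3_par i \<noteq> p \<longrightarrow> x i = 0}"

definition Z2 :: vec where "Z2 = basis_vec 1"

definition g3_grade :: "int \<Rightarrow> vec set" where
  "g3_grade k = {x \<in> g3. g3_br Z2 x = vsmul (of_int k) x}"

definition g3_m :: "vec set" where
  "g3_m = {vadd (vadd a b) c | a b c. a \<in> g3_grade (-3) \<and> b \<in> g3_grade (-2) \<and> c \<in> g3_grade (-1)}"

text \<open>Spencer 1-cochains of degree d and parity p: linear maps phi : m -> g (only their values on m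
  matter) that are homogeneous of parity p and map g_j into g_{j+d}.\<close>
definition spencer_cochain1 :: "int \<Rightarrow> nat \<Rightarrow> (vec \<Rightarrow> vec) \<Rightarrow> bool" where
  "spencer_cochain1 d p \<phi> \<longleftrightarrow>
     (\<forall>x\<in>g3_m. \<forall>y\<in>g3_m. \<phi> (vadd x y) = vadd (\<phi> x) (\<phi> y)) \<and>
     (\<forall>c. \<forall>x\<in>g3_m. \<phi> (vsmul c x) = vsmul c (\<phi> x)) \<and>
     (\<forall>j\<in>{-3,-2,-1}. \<forall>q\<in>{0,1}. \<forall>x \<in> g3_grade j \<inter> g3_parity_part q.
         \<phi> x \<in> g3_grade (j + d) \<inter> g3_parity_part ((q + p) mod 2))"

text \<open>Chevalley--Eilenberg differential (super signs) applied to a 1-cochain of parity p: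
  (d phi)(x,y) = (-1)^{|x| p} [x, phi y] - (-1)^{|y|(|x|+p)} [y, phi x] - phi [x,y],
  so phi is a cocycle iff this vanishes for all homogeneous x, y in m.\<close>
definition spencer_cocycle1 :: "nat \<Rightarrow> (vec \<Rightarrow> vec) \<Rightarrow> bool" where
  "spencer_cocycle1 p \<phi> \<longleftrightarrow>
     (\<forall>qx\<in>{0,1}. \<forall>qy\<in>{0,1}. \<forall>x \<in> g3_m \<inter> g3_parity_part qx. \<forall>y \<in> g3_m \<inter> g3_parity_part qy.
        vadd (vadd (vsmul ((-1) ^ (qx * p)) (g3_br x (\<phi> y)))
                   (vsmul (- ((-1) ^ (qy * (qx + p)))) (g3_br y (\<phi> x))))
             (vsmul (-1) (\<phi> (g3_br x y))) = vzero)"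

definition spencer_coboundary1 :: "int \<Rightarrow> nat \<Rightarrow> (vec \<Rightarrow> vec) \<Rightarrow> bool" where
  "spencer_coboundary1 d p \<phi> \<longleftrightarrow>
     (\<exists>v \<in> g3_grade d \<inter> g3_parity_part p.
        \<forall>qx\<in>{0,1}. \<forall>x \<in> g3_m \<inter> g3_parity_part qx. \<phi> x = vsmul ((-1) ^ (qx * p)) (g3_br x v))"

text \<open>H^{d,1}(m,g) = 0: since the differential preserves degree and parity,
  H^{d,1} is the direct sum of its even and odd parts, and it vanishes iff for each parity p
  every degree-d parity-p cocycle is a coboundary.\<close>
definition spencer_H1_vanishes :: "int \<Rightarrow> bool" where
  "spencer_H1_vanishes d \<longleftrightarrow>
     (\<forall>p\<in>{0,1}. \<forall>\<phi>. spencer_cochain1 d p \<phi> \<and> spencer_cocycle1 p \<phi> \<longrightarrow> spencer_coboundary1 d p \<phi>)"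

end

theory Submission
  imports Defs
begin

text \<open>
  A cochain is determined by its coordinates C(a,b), the coefficient of e_b in phi(e_a), and the
  cocycle condition is a system of linear equations among them that splits by weight with respect
  to the Cartan subalgebra. In each weight that is a root (or 0), one pivot coordinate (three in
  weight 0) can be matched by the coboundary of a suitable v. Starting from the pivots, the
  equations can be ordered so that each one contains exactly one coordinate of phi - dv not yet known
  to vanish; hence phi = dv. Neither the super Jacobi identity nor d d = 0 is needed in general: it
  suffices that dv satisfies the equations actually used. For d at least 0 only the 305 pairs (a,b)
  with deg e_a at most deg e_b matter, and each pair fixes the parity of phi, so that one finite
  certificate covers all degrees and both parities.
\<close>

section \<open>Integer linear forms\<close>

text \<open>Forms are unnormalised lists in which a variable may recur. Integer coefficients keep
  the certificate checks exact; complex numbers enter only on evaluation.\<close>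

definition ev :: "('a \<times> int) list \<Rightarrow> ('a \<Rightarrow> complex) \<Rightarrow> complex" where
  "ev f C = (\<Sum>(x,c)\<leftarrow>f. of_int c * C x)"

definition lin_coeff :: "('a \<times> int) list \<Rightarrow> 'a \<Rightarrow> int" where
  "lin_coeff f x = (\<Sum>(y,c)\<leftarrow>f. if y = x then c else 0)"

text \<open>A finite test for the zero form: variables absent from the list have coefficient 0
  anyway.\<close>

definition null_form :: "('a \<times> int) list \<Rightarrow> bool" where
  "null_form f \<longleftrightarrow> list_all (\<lambda>(x,c). lin_coeff f x = 0) f"

text \<open>Substitution of forms for variables, hence composition of linear maps.\<close>

definition lin_bind :: "('a \<times> int) list \<Rightarrow> ('a \<Rightarrow> ('b \<times> int) list) \<Rightarrow> ('b \<times> int) list" where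
  "lin_bind f g = concat (map (\<lambda>(x,c). map (\<lambda>(y,n). (y, c * n)) (g x)) f)"

lemma ev_simps [simp]:
  "ev [] C = 0" "ev ((x,c) # f) C = of_int c * C x + ev f C" "ev (f @ g) C = ev f C + ev g C"
  by (simp_all add: ev_def)

lemma ev_scale: "ev (map (\<lambda>(y,n). (y, c * n)) f) C = of_int c * ev f C"
  by (induction f) (auto simp: algebra_simps)

lemma ev_bind: "ev (lin_bind f g) C = ev f (\<lambda>x. ev (g x) C)"
  by (induction f) (auto simp: lin_bind_def ev_scale)

text \<open>A fixed superset \<open>A\<close> of the variables lets the induction pass to the tail,
  which may have fewer variables.\<close>

lemma ev_eq_sum_coeff:
  assumes "finite A" "fst ` set f \<subseteq> A"
  shows "ev f C = (\<Sum>x\<in>A. of_int (lin_coeff f x) * C x)"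
  using assms(2)
proof (induction f)
  case Nil
  then show ?case by (simp add: lin_coeff_def)
next
  case (Cons yc f)
  obtain y c where yc: "yc = (y, c)" by force
  have "(\<Sum>x\<in>A. of_int (lin_coeff (yc # f) x) * C x)
      = (\<Sum>x\<in>A. (if y = x then of_int c * C x else 0) + of_int (lin_coeff f x) * C x)"
    by (rule sum.cong) (auto simp: yc lin_coeff_def algebra_simps)
  also have "\<dots> = of_int c * C y + ev f C"
    using Cons assms(1) by (auto simp: sum.distrib yc)
  finally show ?case by (simp add: yc)
qed

lemma ev_null_form:
  assumes "null_form f"
  shows "ev f C = 0"
proof -
  have "ev f C = (\<Sum>x\<in>fst ` set f. of_int (lin_coeff f x) * C x)"
    by (rule ev_eq_sum_coeff) auto
  also have "\<dots> = 0"
    using assms by (intro sum.neutral) (auto simp: null_form_def list_all_iff)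
  finally show ?thesis .
qed

lemma ev_single:
  assumes "\<And>y c. (y,c) \<in> set f \<Longrightarrow> y = x \<or> C y = 0"
  shows "ev f C = of_int (lin_coeff f x) * C x"
  using assms
proof (induction f)
  case Nil
  then show ?case by (simp add: lin_coeff_def)
next
  case (Cons yc f)
  obtain y c where yc: "yc = (y, c)" by force
  have "ev f C = of_int (lin_coeff f x) * C x"
    using Cons by auto
  moreover have "y = x \<or> C y = 0"
    using Cons.prems yc by auto
  ultimately show ?case
    by (auto simp: yc lin_coeff_def algebra_simps)
qed

section \<open>The structure constants\<close>

text \<open>The coefficient of alpha_2 in the root; \<open>g3_br_Z2\<close> identifies it with the
  eigenvalue of ad Z_2.\<close>

definition gr :: "nat \<Rightarrow> int" where "gr i = fst (snd (g3_root_tbl ! i))"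

text \<open>Indices of a basis of m; see \<open>g3_m_iff\<close>.\<close>

definition neg_idx :: "nat list" where "neg_idx = [3,4,5,6,8,21,22,23,24,25,26]"

text \<open>Entries (j,k,c) with c twice the coefficient of e_k in [e_i,e_j]; the factor 2 clears all
  denominators.\<close>

definition ad_row :: "nat \<Rightarrow> (nat \<times> nat \<times> int) list" where
  "ad_row i = concat (map (\<lambda>(a,j,k,p,q). if a = i then [(j, k, 2 * p div q)] else []) g3_sc_tbl)"

text \<open>Spelled out so that quantification over the basis unfolds into finitely many
  cases.\<close>

definition all_idx :: "nat list" where
  "all_idx = [0,1,2,3,4,5,6,7,8,9,10,11,12,13,14,15,16,17,18,19,20,21,22,23,24,25,26,27,28,29,30]"

lemma all_idx_iff: "i \<in> set all_idx \<longleftrightarrow> i < 31"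
  by (simp add: all_idx_def) presburger

lemma g3_par_eq: "i < 31 \<Longrightarrow> g3_par i = (if i < 17 then 0 else 1)"
  unfolding all_idx_iff[symmetric] by (auto simp: all_idx_def g3_par_def g3_par_tbl_def)

lemma gr_simps [simp]:
  "gr 0 = 0" "gr 1 = 0" "gr (Suc 0) = 0" "gr 2 = 0" "gr 3 = -3" "gr 4 = -3" "gr 5 = -2" "gr 6 = -1"
  "gr 7 = 0" "gr 8 = -1" "gr 9 = 1" "gr 10 = 0" "gr 11 = 1" "gr 12 = 2" "gr 13 = 3" "gr 14 = 3"
  "gr 15 = 0" "gr 16 = 0" "gr 17 = 1" "gr 18 = 1" "gr 19 = 1" "gr 20 = 1" "gr 21 = -2"
  "gr 22 = -2" "gr 23 = -1" "gr 24 = -1" "gr 25 = -1" "gr 26 = -1" "gr 27 = 2" "gr 28 = 2"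
  "gr 29 = 0" "gr 30 = 0"
  by (simp_all add: gr_def g3_root_tbl_def)

lemma gr_neg_iff:
  assumes "i < 31"
  shows "gr i < 0 \<longleftrightarrow> i \<in> set neg_idx" and "gr i < 0 \<longleftrightarrow> gr i \<in> {-3,-2,-1}"
  using assms unfolding all_idx_iff[symmetric] by (auto simp: all_idx_def neg_idx_def)

lemma neg_idx_less: "i \<in> set neg_idx \<Longrightarrow> i < 31"
  by (auto simp: neg_idx_def)

text \<open>A single pass over the table. Divisibility makes the division in \<open>ad_row\<close>
  exact; the last two clauses make the bracket additive in degree and parity.\<close>

lemma tbl_props:
  "list_all (\<lambda>(a,b,c,p,q). a < 31 \<and> b < 31 \<and> c < 31 \<and> q dvd 2 * p \<and> q \<noteq> 0 \<and>
      gr c = gr a + gr b \<and> g3_par c = (g3_par a + g3_par b) mod 2) g3_sc_tbl"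
  unfolding g3_sc_tbl_def by (simp add: g3_par_eq)

text \<open>Row 1 is ad Z_2 and serves the grading; the other rows belong to the basis of m and
  enter the two differentials.\<close>

lemmas ad_rows =
  ad_row_def[of 1, unfolded g3_sc_tbl_def, simplified]
  ad_row_def[of 3, unfolded g3_sc_tbl_def, simplified]
  ad_row_def[of 4, unfolded g3_sc_tbl_def, simplified]
  ad_row_def[of 5, unfolded g3_sc_tbl_def, simplified]
  ad_row_def[of 6, unfolded g3_sc_tbl_def, simplified]
  ad_row_def[of 8, unfolded g3_sc_tbl_def, simplified]
  ad_row_def[of 21, unfolded g3_sc_tbl_def, simplified]
  ad_row_def[of 22, unfolded g3_sc_tbl_def, simplified]
  ad_row_def[of 23, unfolded g3_sc_tbl_def, simplified]
  ad_row_def[of 24, unfolded g3_sc_tbl_def, simplified]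
  ad_row_def[of 25, unfolded g3_sc_tbl_def, simplified]
  ad_row_def[of 26, unfolded g3_sc_tbl_def, simplified]

section \<open>The propagation certificate\<close>

text \<open>All forms below are scaled by 2, as is the table of structure constants: the coboundary form
  is twice (dv)(e_a)_b in the coordinates of v, the cocycle form twice (d phi)(e_i,e_j)_l in the
  coordinates of phi.\<close>

definition coboundary_form :: "nat \<Rightarrow> nat \<times> nat \<Rightarrow> (nat \<times> int) list" where
  "coboundary_form p = (\<lambda>(a,b). concat (map (\<lambda>(t,b',c).
     if b' = b then [(t, (-1) ^ (g3_par a * p) * c)] else []) (ad_row a)))"

definition cocycle_form :: "nat \<Rightarrow> nat \<Rightarrow> nat \<Rightarrow> nat \<Rightarrow> ((nat \<times> nat) \<times> int) list" where
  "cocycle_form p i j l =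
     concat (map (\<lambda>(k,l',c). if l' = l then [((j,k), (-1) ^ (g3_par i * p) * c)] else []) (ad_row i)) @
     concat (map (\<lambda>(k,l',c). if l' = l then [((i,k), - ((-1) ^ (g3_par j * (g3_par i + p))) * c)] else [])
       (ad_row j)) @
     concat (map (\<lambda>(j',k,c). if j' = j then [((k,l), (-1) * c)] else []) (ad_row i))"

text \<open>An entry (t,a,b,n) contributes n C(a,b) to twice the t-th coordinate of v; obtained by solving
  C = dv at the pivots.\<close>

definition gauge_tbl :: "(nat \<times> nat \<times> nat \<times> int) list" where
  "gauge_tbl = [(0,25,25,2), (0,23,23,-2), (1,23,23,2), (2,6,6,2), (2,23,23,-2), (7,8,6,-2), (9,8,1,-4),
    (10,6,8,-2), (11,6,1,-2), (12,23,19,2), (13,8,12,-2), (14,6,12,2), (15,24,23,-2),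
    (16,23,24,-2), (17,6,29,2), (18,6,30,2), (19,8,29,-2), (20,8,30,-2), (27,6,19,2),
    (28,6,20,2), (29,6,23,1), (30,6,24,1)]"

definition gauge :: "nat \<Rightarrow> ((nat \<times> nat) \<times> int) list" where
  "gauge t = concat (map (\<lambda>(t',a,b,n). if t' = t then [((a,b), n)] else []) gauge_tbl)"

text \<open>The parity of the elementary map sending e_a to e_b, which fixes the signs in both
  differentials.\<close>

definition pair_par :: "nat \<times> nat \<Rightarrow> nat" where
  "pair_par = (\<lambda>(a,b). (g3_par a + g3_par b) mod 2)"

text \<open>The -4 balances two doublings: \<open>gauge\<close> yields twice v, and
  \<open>coboundary_form\<close> yields twice dv.\<close>

definition pivot_ok :: "nat \<times> nat \<Rightarrow> bool" where
  "pivot_ok x \<longleftrightarrow> null_form ((x, -4) # lin_bind (coboundary_form (pair_par x) x) gauge)"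

text \<open>The last clause says that dv satisfies this one equation for every v; the two before it
  make the equation solvable for \<open>x\<close> once \<open>zs\<close> is settled.\<close>

definition step_ok :: "(nat \<times> nat) list \<Rightarrow> nat \<Rightarrow> nat \<Rightarrow> nat \<Rightarrow> nat \<times> nat \<Rightarrow> bool" where
  "step_ok zs i j l x \<longleftrightarrow>
     (let f = cocycle_form (pair_par x) i j l in
       i \<in> set neg_idx \<and> j \<in> set neg_idx \<and> l < 31 \<and>
       list_all (\<lambda>(y,c). y = x \<or> y \<in> set zs) f \<and> lin_coeff f x \<noteq> 0 \<and>
       null_form (lin_bind f (coboundary_form (pair_par x))))"

fun steps_ok :: "(nat \<times> nat) list \<Rightarrow> (nat \<times> nat \<times> nat \<times> nat \<times> nat) list \<Rightarrow> bool" where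
  "steps_ok zs [] = True"
| "steps_ok zs ((i,j,l,a,b) # ss) \<longleftrightarrow> step_ok zs i j l (a,b) \<and> steps_ok ((a,b) # zs) ss"

text \<open>One entry per weight: the pivots, then steps (i,j,l,a,b) meaning that the equation at
  (e_i,e_j), coordinate l, determines the coordinate (a,b) from those listed before it.\<close>

definition certificate ::
    "((nat \<times> nat) list \<times> (nat \<times> nat \<times> nat \<times> nat \<times> nat) list) list" where
  "certificate = [
    ([], [(6,23,22,23,26)]),
    ([], [(5,23,4,23,8), (6,21,4,6,26)]),
    ([(6,8)], [(5,6,4,3,4), (6,23,21,23,25), (6,24,22,24,26)]),
    ([], [(5,24,4,24,8), (6,22,4,6,25)]),
    ([], [(6,24,21,24,25)]),
    ([(23,24)], [(8,23,22,21,22), (21,25,4,25,26)]),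
    ([(6,24)], [(6,21,3,21,5), (8,21,4,8,26), (6,8,22,5,22), (6,25,5,25,8), (8,23,5,23,6)]),
    ([(23,23), (6,6), (25,25)], [(6,25,21,21,21), (8,23,21,8,8), (6,8,5,5,5), (23,26,5,26,26),
      (24,25,5,24,24), (5,6,3,3,3), (5,8,4,4,4), (6,26,22,22,22)]),
    ([(6,23)], [(6,22,3,22,5), (8,22,4,8,25), (6,8,21,5,21), (6,26,5,26,8), (8,24,5,24,6)]),
    ([(24,23)], [(8,24,21,22,21), (22,26,4,26,25)]),
    ([], [(8,25,22,25,24)]),
    ([], [(5,25,3,25,6), (8,21,3,8,24)]),
    ([(8,6)], [(5,8,3,4,3), (8,25,21,25,23), (8,26,22,26,24)]),
    ([], [(5,26,3,26,6), (8,22,3,8,23)]),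
    ([], [(8,26,21,26,23)]),
    ([], [(3,23,4,23,10)]),
    ([], [(3,6,4,6,10)]),
    ([], [(3,24,4,24,10)]),
    ([], [(21,23,22,23,16)]),
    ([], [(5,23,22,23,30), (21,21,4,21,26), (6,21,22,6,16)]),
    ([(6,30)], [(23,23,23,23,1), (6,8,26,5,26), (6,21,5,21,8), (5,6,22,3,22), (6,23,6,23,2),
      (6,25,8,25,10), (21,24,22,24,16), (23,25,25,23,0)]),
    ([(6,1)], [(6,23,23,23,29), (23,24,6,24,30), (23,26,8,5,8), (6,24,24,6,2), (4,6,4,6,0),
      (6,25,25,21,25), (8,23,25,8,10), (8,24,26,22,26), (21,24,5,3,5)]),
    ([(6,29)], [(6,8,25,5,25), (6,22,5,22,8), (5,6,21,3,21), (6,26,8,26,10), (22,23,21,23,15),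
      (23,24,23,24,1), (24,24,24,24,2), (4,24,4,24,0)]),
    ([], [(5,24,21,24,29), (22,22,4,22,25), (6,22,21,6,15)]),
    ([], [(22,24,21,24,15)]),
    ([], [(21,25,22,25,16)]),
    ([], [(5,25,22,25,30), (21,21,3,21,24), (8,21,22,8,16)]),
    ([(8,30)], [(6,8,24,5,24), (8,21,5,21,6), (5,8,22,4,22), (8,23,6,23,7), (21,26,22,26,16),
      (23,25,23,25,1), (25,25,25,25,0), (3,25,3,25,2)]),
    ([(8,1)], [(8,23,23,21,23), (21,22,3,22,24), (8,24,24,8,2), (8,21,21,8,0), (8,26,26,26,30),
      (5,26,22,5,6), (24,25,6,25,29), (6,25,23,6,7), (21,26,5,4,5)]),
    ([(8,29)], [(6,8,23,5,23), (8,22,5,22,6), (23,26,23,26,1), (5,8,21,4,21), (6,26,6,26,2),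
      (8,24,6,24,7), (22,25,21,25,15), (25,26,25,26,0)]),
    ([], [(5,26,21,26,29), (22,22,3,22,23), (8,22,21,8,15)]),
    ([], [(22,26,21,26,15)]),
    ([], [(4,25,3,25,7)]),
    ([], [(4,8,3,8,7)]),
    ([], [(4,26,3,26,7)]),
    ([], [(3,23,22,23,18)]),
    ([], [(5,23,8,23,11), (6,23,2,6,18), (3,6,22,3,26), (3,21,4,21,10)]),
    ([], [(6,21,25,6,11), (23,23,15,23,17), (24,24,16,24,18), (3,6,5,3,8), (5,23,25,5,10)]),
    ([], [(5,24,8,24,11), (6,23,15,6,17), (3,6,21,3,25), (3,22,4,22,10)]),
    ([], [(3,24,21,24,17)]),
    ([], [(6,25,16,21,16)]),
    ([], [(3,25,22,25,18), (4,23,22,23,20), (6,8,16,5,16), (6,21,24,21,30)]),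
    ([(6,20)], [(4,6,22,4,26), (4,23,5,23,9), (5,23,6,5,30), (5,25,8,25,11), (6,25,2,21,2),
      (6,26,16,22,16), (8,23,1,21,1), (8,23,2,8,18), (5,6,24,3,24), (6,25,0,21,0)]),
    ([(23,19)], [(6,8,2,5,2), (4,23,21,4,8), (4,24,22,24,20), (5,23,23,5,1), (23,25,15,25,17),
      (24,26,16,26,18), (5,25,25,5,0), (21,26,8,21,29), (22,25,8,22,30), (3,5,3,3,6), (5,6,6,6,9),
      (5,8,8,8,11)]),
    ([(6,19)], [(4,6,21,4,25), (4,24,5,24,9), (5,24,6,5,29), (5,26,8,26,11), (6,25,15,21,15),
      (6,26,2,22,2), (8,23,15,8,17), (5,6,23,3,23), (6,22,6,22,1), (6,26,0,22,0)]),
    ([], [(3,26,21,26,17), (4,24,21,24,19), (6,8,15,5,15), (6,22,23,22,29)]),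
    ([], [(6,26,15,22,15)]),
    ([], [(4,25,22,25,20)]),
    ([], [(5,25,6,25,9), (8,25,2,8,20), (4,8,22,4,24), (4,21,3,21,7)]),
    ([], [(8,21,23,8,9), (25,25,15,25,19), (26,26,16,26,20), (4,8,5,4,6), (5,25,23,5,7)]),
    ([], [(5,26,6,26,9), (8,25,15,8,19), (4,8,21,4,23), (4,22,3,22,7)]),
    ([], [(4,26,21,26,19)]),
    ([], [(3,6,8,3,10)]),
    ([], [(3,25,26,3,16), (4,23,26,23,28), (5,21,26,21,18)]),
    ([], [(3,8,26,3,30), (4,6,26,6,28), (4,23,8,23,12), (5,23,0,5,18), (6,21,0,21,11)]),
    ([(6,12)], [(5,6,2,3,2), (4,6,8,4,10), (4,23,25,23,27), (4,24,26,24,28), (5,8,10,5,11),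
      (5,21,25,21,17), (5,22,26,22,18), (21,24,0,3,0), (22,23,1,3,1)]),
    ([], [(3,8,25,3,29), (4,6,25,6,27), (4,24,8,24,12), (5,23,15,5,17), (6,22,0,22,11)]),
    ([], [(3,26,25,3,15), (4,24,25,24,27), (5,22,25,22,17)]),
    ([], [(3,25,24,25,28), (4,23,24,4,16), (5,21,24,21,20)]),
    ([], [(3,8,24,8,28), (3,25,6,25,12), (4,6,24,4,30), (5,23,7,5,20), (6,21,7,21,9)]),
    ([(8,12)], [(4,23,23,4,1), (5,8,2,4,2), (3,8,6,3,7), (3,25,23,25,27), (3,26,24,26,28),
      (5,6,7,5,9), (5,8,0,4,0), (5,21,23,21,19), (5,22,24,22,20)]),
    ([], [(3,8,23,8,27), (3,26,6,26,12), (4,6,23,4,29), (5,24,7,5,19), (6,22,7,22,9)]),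
    ([], [(3,26,23,26,27), (4,24,23,4,15), (5,22,23,22,19)]),
    ([], [(4,8,6,4,7)]),
    ([], [(3,5,26,3,18), (3,23,1,23,14)]),
    ([], [(3,5,8,3,11), (4,6,10,6,14)]),
    ([], [(3,5,25,3,17), (4,24,10,24,14)]),
    ([], [(3,21,24,21,28)]),
    ([], [(3,8,30,3,20), (4,6,30,4,18), (5,21,2,5,28), (6,21,9,21,12), (3,23,7,23,13),
      (3,25,0,25,14)]),
    ([], [(3,25,29,3,9), (4,6,1,4,11), (5,23,19,5,12), (21,21,15,21,27), (22,22,16,22,28),
      (3,6,7,6,13), (3,8,0,8,14)]),
    ([], [(3,8,29,3,19), (4,6,29,4,17), (5,21,15,5,27), (6,22,9,22,12), (3,24,7,24,13),
      (3,26,0,26,14)]),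
    ([], [(3,22,23,22,27)]),
    ([], [(3,25,7,25,13), (4,5,24,4,20)]),
    ([], [(3,8,7,8,13), (4,5,6,4,9)]),
    ([], [(3,26,7,26,13), (4,5,23,4,19)]),
    ([], [(3,4,26,3,28), (3,21,0,21,14)]),
    ([], [(3,4,8,3,12), (3,5,0,5,14)]),
    ([], [(3,4,25,3,27), (3,22,0,22,14)]),
    ([], [(3,4,24,4,28), (3,21,7,21,13)]),
    ([], [(3,4,6,4,12), (3,5,7,5,13)]),
    ([], [(3,4,23,4,27), (3,22,7,22,13)]),
    ([], [(3,4,10,3,14)]),
    ([], [(3,4,1,4,14), (3,5,9,3,13)]),
    ([], [(3,4,7,4,13)])]"

lemma certificate_ok: "list_all (\<lambda>(zs,ss). list_all pivot_ok zs \<and> steps_ok zs ss) certificate"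
  unfolding certificate_def
  by (simp add: step_ok_def pivot_ok_def null_form_def lin_bind_def cocycle_form_def
    coboundary_form_def gauge_def gauge_tbl_def lin_coeff_def neg_idx_def pair_par_def ad_rows g3_par_eq)

definition certified :: "(nat \<times> nat) list" where
  "certified = concat (map (\<lambda>(zs,ss). zs @ map (\<lambda>(i,j,l,x). x) ss) certificate)"

text \<open>Completeness of the certificate in nonnegative degree: the coordinate (a,b) has degree
  \<open>gr b - gr a\<close>.\<close>

lemma certified_cover:
  "list_all (\<lambda>a. list_all (\<lambda>b. gr a \<le> gr b \<longrightarrow> (a,b) \<in> set certified) all_idx) neg_idx"
  by (simp add: certified_def certificate_def neg_idx_def all_idx_def)

text \<open>Homogeneity of the gauge: v inherits degree and parity from the cochain.\<close>

lemma gauge_tbl_props: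
  "list_all (\<lambda>(t,a,b,n). t < 31 \<and> gr b = gr a + gr t \<and> g3_par t = pair_par (a,b)) gauge_tbl"
  unfolding gauge_tbl_def by (simp add: g3_par_eq pair_par_def)

section \<open>Gauge fixing and propagation\<close>

text \<open>\<open>g3_sc\<close> and \<open>ad_row\<close> are read off the same table, so induction
  over an arbitrary table \<open>T\<close> compares them entry by entry. The arbitrary
  \<open>F\<close> later encodes which entries are selected.\<close>

lemma sc_row_sum:
  "(\<Sum>j<31. \<Sum>k<31. g3_sc i j k * F j k) = (\<Sum>(j,k,c)\<leftarrow>ad_row i. of_int c * F j k) / 2"
proof -
  have "(\<Sum>j<31. \<Sum>k<31. (\<Sum>(a,b,c,p,q)\<leftarrow>T.
           if a = i \<and> b = j \<and> c = k then of_int p / of_int q else 0) * F j k)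
      = (\<Sum>(j,k,c)\<leftarrow>concat (map (\<lambda>(a,j,k,p,q). if a = i then [(j, k, 2 * p div q)] else []) T).
           of_int c * F j k) / 2"
    if "list_all (\<lambda>(a,b,c,p,q). b < 31 \<and> c < 31 \<and> q dvd 2 * p \<and> q \<noteq> 0) T"
    for T :: "(nat \<times> nat \<times> nat \<times> int \<times> int) list"
    using that
  proof (induction T)
    case Nil
    then show ?case by simp
  next
    case (Cons e T)
    obtain a b c p q where e: "e = (a,b,c,p,q)" by (cases e)
    let ?r = "of_int p / of_int q :: complex"
    have bc: "b < 31" "c < 31" and q: "q dvd 2 * p" "q \<noteq> 0"
      using Cons.prems by (auto simp: e)
    have half: "of_int (2 * p div q) = 2 * ?r"
    proof -
      obtain m where m: "2 * p = q * m" using q(1) by (elim dvdE)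
      then have "2 * of_int p = (of_int q * of_int m :: complex)"
        by (metis of_int_mult of_int_numeral)
      with m q(2) show ?thesis by simp
    qed
    \<comment> \<open>Nested conditionals in this order let the inner and then the outer sum
      collapse to one term.\<close>
    have "(if a = i \<and> b = j \<and> c = k then ?r else 0) * F j k
        = (if c = k then if b = j then if a = i then ?r * F b c else 0 else 0 else 0)" for j k
      by simp
    then have "(\<Sum>j<31. \<Sum>k<31. (if a = i \<and> b = j \<and> c = k then ?r else 0) * F j k)
        = (if a = i then ?r * F b c else 0)"
      using bc by simp
    moreover note Cons
    ultimately show ?case
      by (auto simp: e distrib_right sum.distrib half add_divide_distrib simp del: of_int_mult)
  qed
  moreover have "list_all (\<lambda>(a,b,c,p,q). b < 31 \<and> c < 31 \<and> q dvd 2 * p \<and> q \<noteq> 0) g3_sc_tbl"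
    using tbl_props by (auto simp: list_all_iff)
  ultimately show ?thesis
    by (simp add: g3_sc_def ad_row_def)
qed

text \<open>The common shape of all blocks in both differentials: \<open>P\<close> selects entries
  of the row, \<open>x\<close> names the variable and \<open>s\<close> is the sign.\<close>

lemma ev_row:
  "ev (concat (map (\<lambda>(j,k,c). if P j k then [(x j k, s * c)] else []) (ad_row i))) C
    = 2 * of_int s * (\<Sum>j<31. \<Sum>k<31. g3_sc i j k * (if P j k then C (x j k) else 0))"
proof -
  have "ev (concat (map (\<lambda>(j,k,c). if P j k then [(x j k, s * c)] else []) R)) C
      = of_int s * (\<Sum>(j,k,c)\<leftarrow>R. of_int c * (if P j k then C (x j k) else 0))" for R
    by (induction R) (auto simp: algebra_simps)
  then show ?thesis by (simp add: sc_row_sum)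
qed

lemma ev_coboundary_form:
  assumes "b < 31"
  shows "ev (coboundary_form p (a,b)) v = 2 * (-1) ^ (g3_par a * p) * (\<Sum>t<31. g3_sc a t b * v t)"
  using assms ev_row[of "\<lambda>t b'. b' = b" "\<lambda>t b'. t" "(-1) ^ (g3_par a * p)" a v]
  by (simp add: coboundary_form_def if_distrib[of "(*) _"] cong: if_cong)

lemma ev_cocycle_form:
  assumes "j < 31" "l < 31"
  shows "ev (cocycle_form p i j l) C = 2 * (
     (-1) ^ (g3_par i * p) * (\<Sum>k<31. g3_sc i k l * C (j,k))
     - (-1) ^ (g3_par j * (g3_par i + p)) * (\<Sum>k<31. g3_sc j k l * C (i,k))
     - (\<Sum>k<31. g3_sc i j k * C (k,l)))"
proof -
  have "(\<Sum>j'<31. \<Sum>k<31. g3_sc i j' k * (if j' = j then C (k,l) else 0))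
      = (\<Sum>j'<31. if j' = j then \<Sum>k<31. g3_sc i j k * C (k,l) else 0)"
    by (intro sum.cong) auto
  also have "\<dots> = (\<Sum>k<31. g3_sc i j k * C (k,l))"
    using assms by simp
  finally show ?thesis
    using assms ev_row[of "\<lambda>k l'. l' = l" "\<lambda>k l'. (j,k)" "(-1) ^ (g3_par i * p)" i C]
      ev_row[of "\<lambda>k l'. l' = l" "\<lambda>k l'. (i,k)" "- ((-1) ^ (g3_par j * (g3_par i + p)))" j C]
      ev_row[of "\<lambda>j' k. j' = j" "\<lambda>j' k. (k,l)" "-1" i C]
    by (simp add: cocycle_form_def if_distrib[of "(*) _"] algebra_simps cong: if_cong)
qed

lemma ev_nonzero:
  assumes "ev f C \<noteq> 0"
  obtains x c where "(x,c) \<in> set f" "C x \<noteq> 0"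
proof -
  have "\<exists>(x,c)\<in>set f. C x \<noteq> 0"
    using assms by (induction f) auto
  then show ?thesis using that by blast
qed

lemma ev_linear:
  "ev f (\<lambda>x. C x / r) = ev f C / r"
  "ev f (\<lambda>x. r * C x - D x) = r * ev f C - ev f D"
  by (induction f) (auto simp: algebra_simps add_divide_distrib)

lemma g3_sc_support:
  assumes "g3_sc i j k \<noteq> 0"
  shows "i < 31" "j < 31" "k < 31" "gr k = gr i + gr j" "g3_par k = (g3_par i + g3_par j) mod 2"
proof -
  have "(\<Sum>(a,b,c,p,q)\<leftarrow>T. if a = i \<and> b = j \<and> c = k then of_int p / of_int q else 0) = (0::complex)"
    if "\<forall>p q. (i,j,k,p,q) \<notin> set T" for T :: "(nat \<times> nat \<times> nat \<times> int \<times> int) list"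
    using that by (induction T) fastforce+
  then obtain p q where "(i,j,k,p,q) \<in> set g3_sc_tbl"
    using assms unfolding g3_sc_def by meson
  then show "i < 31" "j < 31" "k < 31" "gr k = gr i + gr j" "g3_par k = (g3_par i + g3_par j) mod 2"
    using tbl_props by (auto simp: list_all_iff)
qed

lemma g3_par_less_2: "i < 31 \<Longrightarrow> g3_par i < 2"
  by (simp add: g3_par_eq)

section \<open>A homogeneous cocycle and the coboundary fitted to it at the pivots\<close>

context
  fixes C :: "nat \<times> nat \<Rightarrow> complex" and d :: int and p :: nat
  assumes hom: "\<And>a b. C (a,b) \<noteq> 0 \<Longrightarrow> gr b = gr a + d \<and> pair_par (a,b) = p"
    and cocycle: "\<And>i j l. i \<in> set neg_idx \<Longrightarrow> j \<in> set neg_idx \<Longrightarrow> l < 31 \<Longrightarrow>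
                    ev (cocycle_form p i j l) C = 0"
begin

definition gauge_vec :: "nat \<Rightarrow> complex" where "gauge_vec t = ev (gauge t) C / 2"

lemma gauge_vec_support:
  assumes "gauge_vec t \<noteq> 0"
  shows "t < 31" "gr t = d" "g3_par t = p"
proof -
  obtain a b n where ab: "((a,b),n) \<in> set (gauge t)" "C (a,b) \<noteq> 0"
    using assms by (auto simp: gauge_vec_def elim: ev_nonzero)
  then have "(t,a,b,n) \<in> set gauge_tbl"
    by (auto simp: gauge_def split: if_splits)
  then have "t < 31 \<and> gr b = gr a + gr t \<and> g3_par t = pair_par (a,b)"
    using gauge_tbl_props by (auto simp: list_all_iff)
  with hom[OF ab(2)] show "t < 31" "gr t = d" "g3_par t = p" by auto
qed

text \<open>Each term of dv pairs a nonzero coordinate of v, of degree d and parity p, with a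
  structure constant, and the bracket is additive in both.\<close>

lemma coboundary_support:
  assumes "ev (coboundary_form p (a,b)) gauge_vec \<noteq> 0"
  shows "gr b = gr a + d" "pair_par (a,b) = p"
proof -
  obtain t c where t: "(t,c) \<in> set (coboundary_form p (a,b))" "gauge_vec t \<noteq> 0"
    using assms by (elim ev_nonzero)
  then obtain q r where "(a,t,b,q,r) \<in> set g3_sc_tbl"
    by (auto simp: coboundary_form_def ad_row_def split: if_splits)
  then have s: "a < 31" "t < 31" "gr b = gr a + gr t" "g3_par b = (g3_par a + g3_par t) mod 2"
    using tbl_props by (auto simp: list_all_iff)
  note g = gauge_vec_support[OF t(2)]
  from s g show "gr b = gr a + d" by simp
  from s g show "pair_par (a,b) = p"
    using g3_par_less_2[of a] g3_par_less_2[of t] unfolding pair_par_def split_def fst_conv snd_conv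
    by presburger
qed

text \<open>Agreement of C with dv at one coordinate; the 2 is the scaling of
  \<open>coboundary_form\<close>.\<close>

definition matched :: "nat \<times> nat \<Rightarrow> bool" where
  "matched x \<longleftrightarrow> 2 * C x = ev (coboundary_form p x) gauge_vec"

lemma pivot_matched:
  assumes "pivot_ok x" "pair_par x = p"
  shows "matched x"
proof -
  have "ev ((x, -4) # lin_bind (coboundary_form p x) gauge) C = 0"
    using assms by (intro ev_null_form) (simp add: pivot_ok_def)
  then have "4 * C x = ev (coboundary_form p x) (\<lambda>t. ev (gauge t) C)"
    by (simp add: ev_bind)
  then show ?thesis
    by (simp add: matched_def gauge_vec_def[abs_def] ev_linear)
qed

text \<open>Both C and dv satisfy the equation, hence so does their difference \<open>?D\<close>. It
  vanishes on \<open>zs\<close>, so only a nonzero multiple of its value at \<open>x\<close>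
  remains.\<close>

lemma step_matched:
  assumes "step_ok zs i j l x" "pair_par x = p" and zs: "\<And>z. z \<in> set zs \<Longrightarrow> matched z"
  shows "matched x"
proof -
  let ?f = "cocycle_form p i j l"
  let ?D = "\<lambda>y. 2 * C y - ev (coboundary_form p y) gauge_vec"
  have "ev (lin_bind ?f (coboundary_form p)) gauge_vec = 0"
    using assms by (intro ev_null_form) (simp add: step_ok_def Let_def)
  moreover have "ev ?f C = 0"
    using assms by (intro cocycle) (simp_all add: step_ok_def Let_def)
  ultimately have "ev ?f ?D = 0"
    by (simp add: ev_linear ev_bind)
  moreover have "ev ?f ?D = of_int (lin_coeff ?f x) * ?D x"
  proof (rule ev_single)
    fix y c assume "(y,c) \<in> set ?f"
    then have "y = x \<or> y \<in> set zs"
      using assms(1,2) by (auto simp: step_ok_def Let_def list_all_iff)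
    then show "y = x \<or> ?D y = 0"
      using zs[of y] by (auto simp only: matched_def diff_self)
  qed
  moreover have "lin_coeff ?f x \<noteq> 0"
    using assms by (simp add: step_ok_def Let_def)
  ultimately show ?thesis by (simp add: matched_def)
qed

text \<open>Both sides vanish by homogeneity. Certificate entries checked with the signs of the
  other parity are thus harmless when p is fixed.\<close>

lemma matched_other_parity:
  assumes "pair_par x \<noteq> p"
  shows "matched x"
proof (cases x)
  case (Pair a b)
  then show ?thesis
    using assms hom[of a b] coboundary_support(2)[of a b] unfolding matched_def by fastforce
qed

lemma steps_matched:
  assumes "steps_ok zs ss" "\<And>z. z \<in> set zs \<Longrightarrow> matched z" "(i,j,l,x) \<in> set ss"
  shows "matched x"
  using assms
proof (induction zs ss rule: steps_ok.induct)
  case (2 zs i' j' l' a b ss)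
  have ab: "matched (a,b)"
    using 2(2,3) step_matched[of zs i' j' l' "(a,b)"] matched_other_parity[of "(a,b)"]
    by (cases "pair_par (a,b) = p") auto
  then have "matched z" if "z \<in> set ((a,b) # zs)" for z
    using that 2(3)[of z] by (cases "z = (a,b)") auto
  with 2 ab show ?case by auto
qed simp

lemma certified_matched:
  assumes "x \<in> set certified"
  shows "matched x"
proof -
  obtain zs ss where zs: "(zs,ss) \<in> set certificate"
      and x: "x \<in> set zs \<or> (\<exists>i j l. (i,j,l,x) \<in> set ss)"
    using assms by (force simp: certified_def)
  have ok: "list_all pivot_ok zs" "steps_ok zs ss"
    using zs certificate_ok by (auto simp: list_all_iff)
  have "matched z" if "z \<in> set zs" for z
    using that ok(1) pivot_matched[of z] matched_other_parity[of z] by (auto simp only: list_all_iff)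
  then show ?thesis
    using x steps_matched[OF ok(2)] by blast
qed

lemma gauge_coboundary:
  assumes "d \<ge> 0" "a \<in> set neg_idx" "b < 31"
  shows "C (a,b) = (-1) ^ (g3_par a * p) * (\<Sum>t<31. g3_sc a t b * gauge_vec t)"
proof -
  have "matched (a,b)"
  proof (cases "gr a \<le> gr b")
    case True
    then have "(a,b) \<in> set certified"
      using certified_cover all_idx_iff[of b] assms(2,3) unfolding list_all_iff by blast
    then show ?thesis by (rule certified_matched)
  next
    \<comment> \<open>The coordinate has negative degree, so C and dv both vanish there.\<close>
    case False
    then show ?thesis
      using \<open>d \<ge> 0\<close> hom[of a b] coboundary_support(1)[of a b] unfolding matched_def by fastforce
  qed
  then show ?thesis
    using assms by (simp add: matched_def ev_coboundary_form)
qed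

end

section \<open>Cochains in coordinates\<close>

lemma g3_br_basis: "g3_br (basis_vec i) y l = (\<Sum>j<31. g3_sc i j l * y j)" if "i < 31" "l < 31"
proof -
  have "g3_br (basis_vec i) y l = (\<Sum>i'<31. if i' = i then \<Sum>j<31. g3_sc i j l * y j else 0)"
    unfolding g3_br_def g3_dim_def if_P[OF that(2)]
    by (intro sum.cong refl) (auto simp: basis_vec_def algebra_simps)
  then show ?thesis using that by simp
qed

lemma g3_br_outside: "l \<ge> 31 \<Longrightarrow> g3_br x y l = 0"
  by (simp add: g3_br_def g3_dim_def)

lemma g3_br_basis_basis: "g3_br (basis_vec i) (basis_vec j) = g3_sc i j" if "i < 31" "j < 31"
proof
  fix l
  show "g3_br (basis_vec i) (basis_vec j) l = g3_sc i j l"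
  proof (cases "l < 31")
    case True
    have "(\<Sum>k<31. g3_sc i k l * basis_vec j k) = (\<Sum>k<31. if k = j then g3_sc i j l else 0)"
      by (intro sum.cong) (auto simp: basis_vec_def)
    with True that show ?thesis by (simp add: g3_br_basis)
  next
    case False
    then show ?thesis using g3_sc_support(3)[of i j l] by (auto simp: g3_br_outside)
  qed
qed

text \<open>Row 1 of the table is diagonal with entries \<open>gr\<close>; this ties the intrinsic
  grading to the root table.\<close>

lemma g3_br_Z2:
  assumes "l < 31"
  shows "g3_br Z2 x l = of_int (gr l) * x l"
proof -
  \<comment> \<open>The indicator of \<open>k = l\<close> creates the double sum that
    \<open>sc_row_sum\<close> turns into a finite list.\<close>
  have "g3_br Z2 x l = (\<Sum>j<31. \<Sum>k<31. g3_sc 1 j k * (if k = l then x j else 0))"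
    using assms by (simp add: Z2_def g3_br_basis if_distrib[of "(*) _"] cong: if_cong)
  also have "\<dots> = of_int (gr l) * x l"
    unfolding sc_row_sum using assms by (auto simp: ad_rows all_idx_def simp flip: all_idx_iff)
  finally show ?thesis .
qed

text \<open>Coordinatewise the eigenvector equation reads (gr i - k) x_i = 0 over a field of
  characteristic 0.\<close>

lemma g3_grade_iff:
  "x \<in> g3_grade k \<longleftrightarrow> (\<forall>i. x i \<noteq> 0 \<longrightarrow> i < 31 \<and> gr i = k)"
proof -
  have "g3_br Z2 x = vsmul (of_int k) x \<longleftrightarrow> (\<forall>i<31. x i \<noteq> 0 \<longrightarrow> gr i = k)" if "x \<in> g3"
  proof -
    have "g3_br Z2 x i = vsmul (of_int k) x i" if "i \<ge> 31" for i
      using that \<open>x \<in> g3\<close> by (simp add: g3_br_outside vsmul_def g3_def g3_dim_def)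
    then have "g3_br Z2 x = vsmul (of_int k) x \<longleftrightarrow> (\<forall>i<31. g3_br Z2 x i = vsmul (of_int k) x i)"
      by (metis linorder_not_less ext)
    also have "\<dots> \<longleftrightarrow> (\<forall>i<31. x i \<noteq> 0 \<longrightarrow> gr i = k)"
      by (auto simp: g3_br_Z2 vsmul_def)
    finally show ?thesis .
  qed
  moreover have "x \<in> g3 \<longleftrightarrow> (\<forall>i. x i \<noteq> 0 \<longrightarrow> i < 31)"
    unfolding g3_def g3_dim_def mem_Collect_eq by (meson linorder_not_less)
  ultimately show ?thesis
    unfolding g3_grade_def mem_Collect_eq by blast
qed

lemma g3_m_iff: "x \<in> g3_m \<longleftrightarrow> (\<forall>i. x i \<noteq> 0 \<longrightarrow> i \<in> set neg_idx)"
proof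
  assume "x \<in> g3_m"
  then obtain a b c where x: "x = vadd (vadd a b) c"
      and abc: "a \<in> g3_grade (-3)" "b \<in> g3_grade (-2)" "c \<in> g3_grade (-1)"
    by (auto simp: g3_m_def)
  show "\<forall>i. x i \<noteq> 0 \<longrightarrow> i \<in> set neg_idx"
  proof (intro allI impI)
    fix i assume "x i \<noteq> 0"
    then have "a i \<noteq> 0 \<or> b i \<noteq> 0 \<or> c i \<noteq> 0"
      by (auto simp: x vadd_def)
    with abc have "i < 31" "gr i < 0"
      by (auto simp: g3_grade_iff)
    then show "i \<in> set neg_idx" by (simp add: gr_neg_iff)
  qed
next
  assume x: "\<forall>i. x i \<noteq> 0 \<longrightarrow> i \<in> set neg_idx"
  \<comment> \<open>The component of x in degree k.\<close>
  define y where "y k = (\<lambda>i. if gr i = k then x i else 0)" for k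
  have "x i = y (-3) i + y (-2) i + y (-1) i" for i
    using x gr_neg_iff[of i] neg_idx_less[of i] by (cases "x i = 0") (auto simp: y_def)
  then have "x = vadd (vadd (y (-3)) (y (-2))) (y (-1))"
    by (auto simp: vadd_def)
  moreover have "y k \<in> g3_grade k" for k
    using x neg_idx_less by (auto simp: g3_grade_iff y_def)
  ultimately show "x \<in> g3_m"
    by (auto simp: g3_m_def)
qed

section \<open>Cochains and cocycles on the basis of m\<close>

text \<open>Linearity is available on m only, so the induction adds one basis vector of m at a time
  and every partial sum stays in m.\<close>

lemma cochain_expand:
  assumes "spencer_cochain1 d p \<phi>" "x \<in> g3_m"
  shows "\<phi> x l = (\<Sum>i\<in>set neg_idx. x i * \<phi> (basis_vec i) l)"
proof -
  have add: "\<phi> (vadd x y) = vadd (\<phi> x) (\<phi> y)" if "x \<in> g3_m" "y \<in> g3_m" for x y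
    using assms(1) that by (auto simp: spencer_cochain1_def)
  have scale: "\<phi> (vsmul c x) = vsmul c (\<phi> x)" if "x \<in> g3_m" for c x
    using assms(1) that by (auto simp: spencer_cochain1_def)
  have "\<phi> (\<lambda>i. if i \<in> A then x i else 0) l = (\<Sum>i\<in>A. x i * \<phi> (basis_vec i) l)"
    if "finite A" "A \<subseteq> set neg_idx" for A
    using that
  proof (induction A)
    case empty
    \<comment> \<open>Scaling by 0 gives that phi maps 0 to 0.\<close>
    have "vzero \<in> g3_m" by (simp add: g3_m_iff vzero_def)
    from scale[OF this, of 0] show ?case
      by (simp add: vsmul_def vzero_def)
  next
    case (insert j A)
    have "(\<lambda>i. if i \<in> insert j A then x i else 0)
        = vadd (vsmul (x j) (basis_vec j)) (\<lambda>i. if i \<in> A then x i else 0)"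
      using insert by (auto simp: vadd_def vsmul_def basis_vec_def)
    moreover have "basis_vec j \<in> g3_m" "vsmul (x j) (basis_vec j) \<in> g3_m"
        "(\<lambda>i. if i \<in> A then x i else 0) \<in> g3_m"
      using insert by (auto simp: g3_m_iff basis_vec_def vsmul_def)
    ultimately show ?case
      using insert by (simp add: add scale) (simp add: vadd_def vsmul_def)
  qed
  from this[of "set neg_idx"] have "\<phi> (\<lambda>i. if i \<in> set neg_idx then x i else 0) l
      = (\<Sum>i\<in>set neg_idx. x i * \<phi> (basis_vec i) l)"
    by simp
  moreover have "(\<lambda>i. if i \<in> set neg_idx then x i else 0) = x"
    using assms(2) by (force simp: g3_m_iff)
  ultimately show ?thesis by simp
qed

lemma basis_vec_parity: "i < 31 \<Longrightarrow> basis_vec i \<in> g3_parity_part (g3_par i)"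
  by (auto simp: g3_parity_part_def g3_def g3_dim_def basis_vec_def)

lemma basis_vec_m: "i \<in> set neg_idx \<Longrightarrow> basis_vec i \<in> g3_m"
  by (auto simp: g3_m_iff basis_vec_def)

lemma cochain_support:
  assumes "spencer_cochain1 d p \<phi>" "p < 2" "a \<in> set neg_idx" "\<phi> (basis_vec a) b \<noteq> 0"
  shows "b < 31" "gr b = gr a + d" "pair_par (a,b) = p"
proof -
  have a: "a < 31" "gr a \<in> {-3,-2,-1}" "g3_par a \<in> {0,1}"
    using assms(3) neg_idx_less gr_neg_iff[of a] by (auto simp: g3_par_eq)
  have "basis_vec a \<in> g3_grade (gr a) \<inter> g3_parity_part (g3_par a)"
    using a by (auto simp: g3_grade_iff basis_vec_parity) (auto simp: basis_vec_def split: if_splits)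
  then have "\<phi> (basis_vec a) \<in> g3_grade (gr a + d) \<inter> g3_parity_part ((g3_par a + p) mod 2)"
    using assms(1) a unfolding spencer_cochain1_def by blast
  then have b: "b < 31" "gr b = gr a + d" "g3_par b = (g3_par a + p) mod 2"
    using assms(4) by (auto simp: g3_grade_iff g3_parity_part_def)
  then show "b < 31" "gr b = gr a + d" by auto
  show "pair_par (a,b) = p"
    using b(3) a(3) assms(2) unfolding pair_par_def split_def fst_conv snd_conv by auto presburger+
qed

text \<open>The form is twice coordinate l of the cocycle identity at two basis vectors of
  m.\<close>

lemma cocycle_coordinates:
  assumes "spencer_cochain1 d p \<phi>" "spencer_cocycle1 p \<phi>"
    and i: "i \<in> set neg_idx" and j: "j \<in> set neg_idx" and l: "l < 31"
  defines "C \<equiv> (\<lambda>(a,b). if a \<in> set neg_idx then \<phi> (basis_vec a) b else 0)"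
  shows "ev (cocycle_form p i j l) C = 0"
proof -
  note lt = neg_idx_less[OF i] neg_idx_less[OF j]
  have par: "g3_par i \<in> {0,1}" "g3_par j \<in> {0,1}"
    using lt by (auto simp: g3_par_eq)
  \<comment> \<open>Negative degrees add up to a negative degree, so m is closed under the bracket
    and the default 0 of \<open>C\<close> off m never replaces a true value.\<close>
  have br: "g3_sc i j k \<noteq> 0 \<Longrightarrow> k \<in> set neg_idx" for k
    using g3_sc_support[of i j k] gr_neg_iff(1)[of i] gr_neg_iff(1)[of j] gr_neg_iff(1)[of k] i j lt
    by auto
  have "vadd (vadd (vsmul ((-1) ^ (g3_par i * p)) (g3_br (basis_vec i) (\<phi> (basis_vec j))))
        (vsmul (- ((-1) ^ (g3_par j * (g3_par i + p)))) (g3_br (basis_vec j) (\<phi> (basis_vec i)))))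
      (vsmul (-1) (\<phi> (g3_br (basis_vec i) (basis_vec j)))) = vzero"
    using assms(2) par i j lt basis_vec_m basis_vec_parity unfolding spencer_cocycle1_def by blast
  then have "(-1) ^ (g3_par i * p) * (\<Sum>k<31. g3_sc i k l * \<phi> (basis_vec j) k)
      - (-1) ^ (g3_par j * (g3_par i + p)) * (\<Sum>k<31. g3_sc j k l * \<phi> (basis_vec i) k)
      - \<phi> (g3_sc i j) l = 0"
    using lt l unfolding g3_br_basis_basis[OF lt]
    by (auto simp: vadd_def vsmul_def vzero_def g3_br_basis dest!: fun_cong[where x = l])
  moreover have "\<phi> (g3_sc i j) l = (\<Sum>k<31. g3_sc i j k * C (k,l))"
  proof -
    have "\<phi> (g3_sc i j) l = (\<Sum>k\<in>set neg_idx. g3_sc i j k * \<phi> (basis_vec k) l)"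
      using assms(1) br by (intro cochain_expand) (auto simp: g3_m_iff)
    also have "\<dots> = (\<Sum>k<31. g3_sc i j k * C (k,l))"
      using neg_idx_less by (intro sum.mono_neutral_cong_left) (auto simp: C_def)
    finally show ?thesis .
  qed
  ultimately show ?thesis
    using i j lt l by (simp add: ev_cocycle_form C_def)
qed

theorem theorem3p16:
  fixes d :: int
  assumes "d \<ge> 0"
  shows "spencer_H1_vanishes d"
  unfolding spencer_H1_vanishes_def
proof (intro ballI allI impI)
  fix p :: nat and \<phi>
  assume "p \<in> {0,1}" and \<phi>: "spencer_cochain1 d p \<phi> \<and> spencer_cocycle1 p \<phi>"
  then have p: "p < 2" by auto
  \<comment> \<open>The value 0 off m makes the homogeneity condition hold for every index
    a.\<close>
  define C where "C = (\<lambda>(a,b). if a \<in> set neg_idx then \<phi> (basis_vec a) b else 0)"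
  have hom: "gr b = gr a + d \<and> pair_par (a,b) = p" if "C (a,b) \<noteq> 0" for a b
    using that cochain_support[of d p \<phi> a b] \<phi> p by (auto simp: C_def split: if_splits)
  have cocycle: "ev (cocycle_form p i j l) C = 0"
    if "i \<in> set neg_idx" "j \<in> set neg_idx" "l < 31" for i j l
    using cocycle_coordinates[of d p \<phi> i j l] that \<phi> by (simp add: C_def)
  \<comment> \<open>The primitive of phi, read off from the pivot coordinates.\<close>
  define v where "v = gauge_vec C"
  have v: "t < 31 \<and> gr t = d \<and> g3_par t = p" if "v t \<noteq> 0" for t
    using gauge_vec_support[of C d p t, OF hom cocycle] that unfolding v_def by blast
  have \<phi>_basis: "\<phi> (basis_vec a) b = (-1) ^ (g3_par a * p) * (\<Sum>t<31. g3_sc a t b * v t)"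
    if "a \<in> set neg_idx" "b < 31" for a b
    using gauge_coboundary[of C d p a b] hom cocycle assms that by (simp add: v_def C_def)
  show "spencer_coboundary1 d p \<phi>"
    unfolding spencer_coboundary1_def
  proof (intro bexI[of _ v] ballI)
    show "v \<in> g3_grade d \<inter> g3_parity_part p"
      using v by (force simp: g3_grade_iff g3_parity_part_def g3_def g3_dim_def)
  next
    fix qx x assume x: "x \<in> g3_m \<inter> g3_parity_part qx"
    show "\<phi> x = vsmul ((-1) ^ (qx * p)) (g3_br x v)"
    proof
      fix l
      have \<phi>x: "\<phi> x l = (\<Sum>i\<in>set neg_idx. x i * \<phi> (basis_vec i) l)"
        using \<phi> x by (intro cochain_expand) auto
      show "\<phi> x l = vsmul ((-1) ^ (qx * p)) (g3_br x v) l"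
      proof (cases "l < 31")
        case True
        have "\<phi> x l = (\<Sum>i\<in>set neg_idx. (-1) ^ (qx * p) * (\<Sum>t<31. x i * v t * g3_sc i t l))"
          unfolding \<phi>x
        proof (intro sum.cong refl)
          fix i assume i: "i \<in> set neg_idx"
          \<comment> \<open>Only basis vectors of parity \<open>qx\<close> occur in x, so the sign
            is the same in every term.\<close>
          have "x i = 0 \<or> g3_par i = qx"
            using x by (auto simp: g3_parity_part_def)
          then show "x i * \<phi> (basis_vec i) l = (-1) ^ (qx * p) * (\<Sum>t<31. x i * v t * g3_sc i t l)"
            using i True by (auto simp: \<phi>_basis sum_distrib_left algebra_simps)
        qed
        \<comment> \<open>x vanishes off m, so the sum extends to the whole basis as in the
          bracket.\<close>
        also have "\<dots> = (\<Sum>i<31. (-1) ^ (qx * p) * (\<Sum>t<31. x i * v t * g3_sc i t l))"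
        proof (intro sum.mono_neutral_left ballI)
          fix i assume "i \<in> {..<31} - set neg_idx"
          then have "x i = 0" using x by (auto simp: g3_m_iff)
          then show "(-1) ^ (qx * p) * (\<Sum>t<31. x i * v t * g3_sc i t l) = 0" by simp
        qed (use neg_idx_less in auto)
        finally show ?thesis
          using True by (simp add: vsmul_def g3_br_def g3_dim_def sum_distrib_left)
      next
        case False
        \<comment> \<open>Beyond the 31 coordinates of g both sides are 0.\<close>
        then have "\<phi> (basis_vec i) l = 0" if "i \<in> set neg_idx" for i
          using cochain_support(1)[of d p \<phi> i l] \<phi> p that by auto
        with False show ?thesis
          by (simp add: \<phi>x vsmul_def g3_br_outside)
      qed
    qed
  qed
qed

end
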